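(* Let $(X,\mathcal{A},m)$ be a non-atomic Lebesgue probability space and let $T$ be an ergodic automorphism of $(X,\mathcal{A},m)$. Let $\mathcal{B}=\{T(B)+B : B\in\mathcal{A}\}$ be the subgroup of coboundaries of the group $(\mathcal{A},+)$, where $+$ is symmetric difference. Then the first cohomology group $\mathcal{H}=\mathcal{A}/\mathcal{B}$ is uncountable.
   Context: A non-atomic Lebesgue probability space is a standard non-atomic probability space (isomorphic mod null sets to $[0,1]$ with Lebesgue measure). Measurable sets that agree up to a set of measure zero are identified, so $\mathcal{A}$ denotes the measure algebra; it is an abelian group under symmetric difference $A+B=A\,\triangle\,B$, with identity $\emptyset$, in which every element satisfies $A+A=\emptyset$. An automorphism $T$ of $(X,\mathcal{A},m)$ is an invertible (mod null sets) bi-measurable map $T:X\to X$ with $m(T(A))=m(A)$ for all $A\in\mathcal{A}$; it acts on $\mathcal{A}$ as a group automorphism $A\mapsto T(A)$. $T$ is ergodic if $\emptyset$ and $X$ are the only elements $A\in\mathcal{A}$ with $T(A)=A$ (mod null sets). Elements of $\mathcal{A}$ are regarded as ($\mathbb{Z}_2$-valued) cocycles, and elements of $\mathcal{B}$ are called coboundaries. *)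

theory Defs
  imports "HOL-Probability.Probability_Measure" "HOL-Algebra.Coset"
begin

definition iso_mod0_on ::
  "'a measure \<Rightarrow> 'b measure \<Rightarrow> 'a set \<Rightarrow> 'b set \<Rightarrow> ('a \<Rightarrow> 'b) \<Rightarrow> bool" where
  "iso_mod0_on M N U V f \<longleftrightarrow>
     U \<in> sets M \<and> space M - U \<in> null_sets M \<and>
     V \<in> sets N \<and> space N - V \<in> null_sets N \<and>
     bij_betw f U V \<and>
     f \<in> restrict_space M U \<rightarrow>\<^sub>M restrict_space N V \<and>
     (\<forall>A\<in>sets M. A \<subseteq> U \<longrightarrow> f ` A \<in> sets N \<and> emeasure N (f ` A) = emeasure M A)"

(* The completion makes the definition cover both conventions: M complete (where completion M
   and M agree) and M a standard Borel probability space. *)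
definition nonatomic_lebesgue_space :: "'a measure \<Rightarrow> bool" where
  "nonatomic_lebesgue_space M \<longleftrightarrow>
     prob_space M \<and> (\<exists>f U V. iso_mod0_on (completion M) (lebesgue_on {0..1::real}) U V f)"

definition automorphism_mod0 :: "'a measure \<Rightarrow> ('a \<Rightarrow> 'a) \<Rightarrow> bool" where
  "automorphism_mod0 M T \<longleftrightarrow> (\<exists>U V. iso_mod0_on M M U V T)"

definition sets_group :: "'a measure \<Rightarrow> 'a set monoid" where
  "sets_group M = \<lparr>carrier = sets M, monoid.mult = sym_diff, one = {}\<rparr>"

definition measure_algebra :: "'a measure \<Rightarrow> 'a set set monoid" where
  "measure_algebra M = sets_group M Mod null_sets M"

definition ae_class :: "'a measure \<Rightarrow> 'a set \<Rightarrow> 'a set set" where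
  "ae_class M A = null_sets M #>\<^bsub>sets_group M\<^esub> A"

(* T may do anything on the null set where it is not invertible, even map it onto the whole space,
   so images are taken inside a conull set U on which T is an isomorphism. The class of the result
   does not depend on U. *)
definition image_mod0 :: "'a measure \<Rightarrow> ('a \<Rightarrow> 'a) \<Rightarrow> 'a set \<Rightarrow> 'a set" where
  "image_mod0 M T A = T ` (A \<inter> (SOME U. \<exists>V. iso_mod0_on M M U V T))"

(* The classes in this union all coincide when T is an automorphism and a is in the measure
   algebra. *)
definition induced_map :: "'a measure \<Rightarrow> ('a \<Rightarrow> 'a) \<Rightarrow> 'a set set \<Rightarrow> 'a set set" where
  "induced_map M T a = (\<Union>A\<in>a. ae_class M (image_mod0 M T A))"

definition ergodic_mod0 :: "'a measure \<Rightarrow> ('a \<Rightarrow> 'a) \<Rightarrow> bool" where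
  "ergodic_mod0 M T \<longleftrightarrow>
     (\<forall>a\<in>carrier (measure_algebra M).
        induced_map M T a = a \<longrightarrow> a = ae_class M {} \<or> a = ae_class M (space M))"

definition coboundaries :: "'a measure \<Rightarrow> ('a \<Rightarrow> 'a) \<Rightarrow> 'a set set set" where
  "coboundaries M T =
     {induced_map M T b \<otimes>\<^bsub>measure_algebra M\<^esub> b | b. b \<in> carrier (measure_algebra M)}"

definition cohomology_group :: "'a measure \<Rightarrow> ('a \<Rightarrow> 'a) \<Rightarrow> 'a set set set monoid" where
  "cohomology_group M T = measure_algebra M Mod coboundaries M T"

(* The sets and maps above are well defined: measure_algebra is an abelian group, induced_map is an
   endomorphism of it that agrees with the pointwise image on any admissible U, and coboundaries is
   a subgroup. *)

lemma sets_group_comm: "comm_group (sets_group M)"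
proof (rule comm_groupI)
  show "\<exists>y\<in>carrier (sets_group M). y \<otimes>\<^bsub>sets_group M\<^esub> x = \<one>\<^bsub>sets_group M\<^esub>"
    if "x \<in> carrier (sets_group M)" for x
    using that by (intro bexI[of _ x]) (auto simp: sets_group_def)
qed (auto simp: sets_group_def)

lemma subgroup_null_sets: "subgroup (null_sets M) (sets_group M)"
proof -
  interpret comm_group "sets_group M" by (rule sets_group_comm)
  have inv: "inv\<^bsub>sets_group M\<^esub> a = a" if "a \<in> sets M" for a
    using that by (intro inv_equality) (auto simp: sets_group_def)
  show ?thesis
  proof (rule subgroupI)
    show "inv\<^bsub>sets_group M\<^esub> a \<in> null_sets M" if "a \<in> null_sets M" for a
      using that by (subst inv) auto
    show "a \<otimes>\<^bsub>sets_group M\<^esub> b \<in> null_sets M" if "a \<in> null_sets M" "b \<in> null_sets M" for a b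
      using that by (simp add: sets_group_def null_sets.Un null_sets.Diff)
    show "null_sets M \<subseteq> carrier (sets_group M)" "null_sets M \<noteq> {}"
      by (auto simp: sets_group_def)
  qed
qed

lemma comm_group_measure_algebra: "comm_group (measure_algebra M)"
  unfolding measure_algebra_def
  by (intro comm_group.abelian_FactGroup sets_group_comm subgroup_null_sets)

lemma ae_class_eq:
  assumes "A \<in> sets M"
  shows "ae_class M A = {B \<in> sets M. sym_diff A B \<in> null_sets M}"
proof (intro Set.set_eqI iffI)
  fix B assume "B \<in> ae_class M A"
  then obtain N where N: "N \<in> null_sets M" "B = sym_diff N A"
    by (auto simp: ae_class_def r_coset_def sets_group_def)
  then have "sym_diff A B = N" by auto
  then show "B \<in> {B \<in> sets M. sym_diff A B \<in> null_sets M}" using N assms by auto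
next
  fix B assume B: "B \<in> {B \<in> sets M. sym_diff A B \<in> null_sets M}"
  moreover have "B = sym_diff (sym_diff A B) A" by auto
  ultimately show "B \<in> ae_class M A"
    unfolding ae_class_def r_coset_def sets_group_def by auto
qed

lemma carrier_measure_algebra: "carrier (measure_algebra M) = ae_class M ` sets M"
  by (auto simp: measure_algebra_def FactGroup_def RCOSETS_def ae_class_def sets_group_def)

lemma image_indep:
  assumes 1: "iso_mod0_on M M U V T" and 2: "iso_mod0_on M M U' V' T"
    and A: "A \<in> sets M" "B \<in> sets M" "sym_diff A B \<in> null_sets M"
  shows "sym_diff (T ` (A \<inter> U)) (T ` (B \<inter> U')) \<in> null_sets M"
proof -
  have n1: "T ` N \<in> null_sets M" if "N \<in> null_sets M" "N \<subseteq> U" for N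
    using 1 that unfolding iso_mod0_on_def by (auto simp: null_sets_def)
  have n2: "T ` N \<in> null_sets M" if "N \<in> null_sets M" "N \<subseteq> U'" for N
    using 2 that unfolding iso_mod0_on_def by (auto simp: null_sets_def)
  have UU: "U \<in> sets M" "U' \<in> sets M" "space M - U \<in> null_sets M" "space M - U' \<in> null_sets M"
    using 1 2 by (auto simp: iso_mod0_on_def)
  let ?N = "(space M - U) \<union> (space M - U') \<union> sym_diff A B"
  have N: "?N \<in> null_sets M" using UU A by auto
  have m: "T ` (A \<inter> U) \<in> sets M" "T ` (B \<inter> U') \<in> sets M"
    using 1 2 A UU unfolding iso_mod0_on_def by auto
  have i: "?N \<inter> U \<in> null_sets M" "?N \<inter> U' \<in> null_sets M"
    using null_set_Int1[OF N UU(1)] null_set_Int1[OF N UU(2)] by (simp_all only: Int_commute)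
  have "T ` (?N \<inter> U) \<union> T ` (?N \<inter> U') \<in> null_sets M"
    using n1[OF i(1)] n2[OF i(2)] by blast
  moreover have "sym_diff (T ` (A \<inter> U)) (T ` (B \<inter> U')) \<subseteq> T ` (?N \<inter> U) \<union> T ` (?N \<inter> U')"
    using sets.sets_into_space[OF A(1)] sets.sets_into_space[OF A(2)] by blast
  moreover have "sym_diff (T ` (A \<inter> U)) (T ` (B \<inter> U')) \<in> sets M" using m by blast
  ultimately show ?thesis using null_sets_subset by blast
qed

lemma ae_class_cong:
  assumes "A \<in> sets M" "B \<in> sets M" "sym_diff A B \<in> null_sets M"
  shows "ae_class M A = ae_class M B"
proof -
  interpret comm_group "sets_group M" by (rule sets_group_comm)
  have "A \<in> carrier (sets_group M)" using assms(1) by (simp add: sets_group_def)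
  moreover have "B \<in> null_sets M #>\<^bsub>sets_group M\<^esub> A"
    using ae_class_eq[OF assms(1)] assms(2,3) unfolding ae_class_def by blast
  ultimately show ?thesis
    unfolding ae_class_def by (intro repr_independence subgroup_null_sets)
qed

lemma induced_map_ae_class:
  assumes 1: "iso_mod0_on M M U V T" and A: "A \<in> sets M"
  shows "induced_map M T (ae_class M A) = ae_class M (T ` (A \<inter> U))"
proof -
  define U' where "U' = (SOME U. \<exists>V. iso_mod0_on M M U V T)"
  obtain V' where 2: "iso_mod0_on M M U' V' T"
    unfolding U'_def using 1 someI_ex[of "\<lambda>U. \<exists>V. iso_mod0_on M M U V T"] by blast
  have m: "T ` (C \<inter> W) \<in> sets M" if "iso_mod0_on M M W W' T" "C \<in> sets M" for C W W'
    using that unfolding iso_mod0_on_def by (meson Int_lower2 sets.Int)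
  have "ae_class M (image_mod0 M T B) = ae_class M (T ` (A \<inter> U))" if "B \<in> ae_class M A" for B
  proof (rule ae_class_cong)
    have B: "B \<in> sets M" "sym_diff A B \<in> null_sets M" using that A by (auto simp: ae_class_eq)
    have B': "sym_diff B A \<in> null_sets M" using B(2) by (subst Un_commute)
    show "image_mod0 M T B \<in> sets M" "T ` (A \<inter> U) \<in> sets M"
      unfolding image_mod0_def U'_def[symmetric] by (rule m[OF 2 B(1)], rule m[OF 1 A])
    show "sym_diff (image_mod0 M T B) (T ` (A \<inter> U)) \<in> null_sets M"
      unfolding image_mod0_def U'_def[symmetric] by (rule image_indep[OF 2 1 B(1) A B'])
  qed
  moreover have "A \<in> ae_class M A" using A by (simp add: ae_class_eq)
  ultimately show ?thesis unfolding induced_map_def by blast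
qed

lemma mult_ae_class:
  assumes "A \<in> sets M" "B \<in> sets M"
  shows "ae_class M A \<otimes>\<^bsub>measure_algebra M\<^esub> ae_class M B = ae_class M (sym_diff A B)"
proof -
  interpret comm_group "sets_group M" by (rule sets_group_comm)
  have "null_sets M \<lhd> sets_group M" by (rule normal_iff_subgroup[THEN iffD2, OF subgroup_null_sets])
  from normal.rcos_sum[OF this, of A B] assms show ?thesis
    by (simp add: measure_algebra_def FactGroup_def ae_class_def sets_group_def)
qed

lemma induced_hom:
  assumes "automorphism_mod0 M T"
  shows "induced_map M T \<in> hom (measure_algebra M) (measure_algebra M)"
proof -
  obtain U V where 1: "iso_mod0_on M M U V T" using assms by (auto simp: automorphism_mod0_def)
  have m: "T ` (A \<inter> U) \<in> sets M" if "A \<in> sets M" for A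
    using 1 that unfolding iso_mod0_on_def by auto
  have inj: "inj_on T U" using 1 by (auto simp: iso_mod0_on_def bij_betw_def)
  have "T ` (sym_diff A B \<inter> U) = sym_diff (T ` (A \<inter> U)) (T ` (B \<inter> U))" for A B
    using inj unfolding inj_on_def by blast
  then show ?thesis
    by (auto simp: hom_def carrier_measure_algebra mult_ae_class induced_map_ae_class[OF 1] m)
qed

lemma subgroup_coboundaries:
  assumes "automorphism_mod0 M T"
  shows "subgroup (coboundaries M T) (measure_algebra M)"
proof -
  let ?A = "measure_algebra M"
  interpret A: comm_group ?A by (rule comm_group_measure_algebra)
  note h = induced_hom[OF assms]
  have "(\<lambda>b. induced_map M T b \<otimes>\<^bsub>?A\<^esub> b) \<in> hom ?A ?A"
    using h unfolding hom_def by (auto simp: A.m_ac Pi_iff)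
  then interpret g: group_hom ?A ?A "\<lambda>b. induced_map M T b \<otimes>\<^bsub>?A\<^esub> b"
    by unfold_locales
  have "coboundaries M T = (\<lambda>b. induced_map M T b \<otimes>\<^bsub>?A\<^esub> b) ` carrier ?A"
    unfolding coboundaries_def by auto
  then show ?thesis using g.img_is_subgroup by simp
qed

end

theory Submission
  imports Defs
begin

text \<open>By ergodicity there are sets \<open>B n\<close> whose coboundaries \<open>E n = T (B n) + B n\<close> have rapidly decreasing
  measure although \<open>B n\<close> is moved by a definite amount under a suitable power of \<open>T\<close>. For every
  set \<open>\<omega>\<close> of natural numbers the infinite sum of the \<open>E n\<close> with \<open>n \<in> \<omega>\<close> is a cocycle, and two different
  such cocycles can only differ by the coboundary of a set of measure at least \<open>1/8\<close>. If there were only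
  countably many cohomology classes, then by separability of the measure algebra two of these
  uncountably many cocycles would differ by the coboundary of a smaller set.\<close>

lemma sets_sym_diff: "A \<in> sets M \<Longrightarrow> B \<in> sets M \<Longrightarrow> sym_diff A B \<in> sets M"
  by simp

section \<open>Separability of Lebesgue spaces\<close>

text \<open>Finite unions of members of a countable base suffice. Regularity gives a closed
  \<open>K\<close> inside \<open>A\<close> and an open \<open>W\<close> around it; boundedness makes
  \<open>K\<close> compact, so finitely many base sets inside \<open>W\<close> cover
  \<open>K\<close>, and their union differs from \<open>A\<close> only within
  \<open>W - K\<close>.\<close>

lemma lebesgue_countable_dense:
  obtains D :: "'a::euclidean_space set set" where "countable D" "D \<subseteq> sets lebesgue"
    "\<And>A e. A \<in> sets lebesgue \<Longrightarrow> bounded A \<Longrightarrow> e > 0 \<Longrightarrow>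
       \<exists>B\<in>D. emeasure lebesgue (sym_diff A B) < ennreal e"
proof -
  obtain \<B> :: "'a set set" where \<B>: "countable \<B>" "topological_basis \<B>"
    using ex_countable_basis by blast
  define D where "D = \<Union> ` {\<C>. finite \<C> \<and> \<C> \<subseteq> \<B>}"
  have opn: "open B" if "B \<in> D" for B
    using that \<B>(2) unfolding D_def by (auto intro!: open_Union dest: topological_basis_open)
  have "\<exists>B\<in>D. emeasure lebesgue (sym_diff A B) < ennreal e"
    if A: "A \<in> sets lebesgue" "bounded A" and e: "e > 0" for A and e :: real
  proof -
    obtain K where K: "closed K" "K \<subseteq> A" "A - K \<in> lmeasurable" "emeasure lebesgue (A - K) < ennreal (e/2)"
      using sets_lebesgue_inner_closed[OF A(1), of "e/2"] e by auto
    obtain W where W: "open W" "A \<subseteq> W" "W - A \<in> lmeasurable" "emeasure lebesgue (W - A) < ennreal (e/2)"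
      using sets_lebesgue_outer_open[OF A(1), of "e/2"] e by auto
    have "compact K"
      using K A(2) by (meson bounded_subset compact_eq_bounded_closed)
    moreover obtain \<W> where \<W>: "\<W> \<subseteq> \<B>" "\<Union>\<W> = W"
      using \<B>(2) W(1) unfolding topological_basis_def by blast
    ultimately obtain \<C> where \<C>: "\<C> \<subseteq> \<W>" "finite \<C>" "K \<subseteq> \<Union>\<C>"
      using compactE[of K \<W>] K(2) W(2) \<B>(2) by (metis subset_iff topological_basis_open)
    have B: "\<Union>\<C> \<in> D" using \<C> \<W> unfolding D_def by blast
    have "emeasure lebesgue (sym_diff A (\<Union>\<C>)) \<le> emeasure lebesgue ((A - K) \<union> (W - A))"
      using \<C> \<W> K W by (intro emeasure_mono) (auto intro!: sets.Un fmeasurableD)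
    also have "\<dots> \<le> emeasure lebesgue (A - K) + emeasure lebesgue (W - A)"
      using K W by (intro emeasure_subadditive) auto
    also have "\<dots> < ennreal (e/2) + ennreal (e/2)"
      using K W by (intro add_strict_mono) auto
    also have "\<dots> = ennreal e"
      using e by (simp flip: ennreal_plus)
    finally show ?thesis using B by blast
  qed
  moreover have "countable D"
    unfolding D_def using \<B>(1) by (intro countable_image countable_Collect_finite_subset)
  moreover have "D \<subseteq> sets lebesgue" using opn by (auto intro: borel_open)
  ultimately show ?thesis using that[of D] by simp
qed

text \<open>Separability in pigeonhole form: the colour of \<open>A\<close> is the index of a member
  of a countable dense family lying within \<open>e/2\<close> of the image of \<open>A\<close> in
  the interval.\<close>

lemma nonatomic_lebesgue_space_colouring:
  assumes M: "nonatomic_lebesgue_space M" and e: "e > 0"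
  obtains c :: "'a set \<Rightarrow> nat" where
    "\<And>A B. A \<in> sets M \<Longrightarrow> B \<in> sets M \<Longrightarrow> c A = c B \<Longrightarrow> measure M (sym_diff A B) < e"
proof -
  interpret prob_space M using M by (simp add: nonatomic_lebesgue_space_def)
  obtain f U V where 1: "iso_mod0_on (completion M) (lebesgue_on {0..1::real}) U V f"
    using M by (auto simp: nonatomic_lebesgue_space_def)
  have U: "U \<in> sets (completion M)" "space M - U \<in> null_sets (completion M)" and inj: "inj_on f U"
    using 1 by (auto simp: iso_mod0_on_def bij_betw_def)
  have img: "f ` A \<in> sets lebesgue" "bounded (f ` A)" "emeasure lebesgue (f ` A) = emeasure (completion M) A"
    if "A \<in> sets (completion M)" "A \<subseteq> U" for A
  proof -
    have *: "f ` A \<in> sets (lebesgue_on {0..1})"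
      "emeasure (lebesgue_on {0..1}) (f ` A) = emeasure (completion M) A"
      using 1 that by (auto simp: iso_mod0_on_def)
    have "f ` A \<subseteq> {0..1}" using sets.sets_into_space[OF *(1)] by simp
    then show "f ` A \<in> sets lebesgue" "bounded (f ` A)" "emeasure lebesgue (f ` A) = emeasure (completion M) A"
      using * by (auto simp: emeasure_restrict_space sets_restrict_space_iff intro: bounded_subset[of "{0..1}"])
  qed
  obtain D :: "real set set" where D: "countable D" "D \<subseteq> sets lebesgue"
    "\<And>A e. A \<in> sets lebesgue \<Longrightarrow> bounded A \<Longrightarrow> e > 0 \<Longrightarrow>
       \<exists>B\<in>D. emeasure lebesgue (sym_diff A B) < ennreal e"
    using lebesgue_countable_dense by blast
  have "\<forall>A\<in>sets M. \<exists>B\<in>D. emeasure lebesgue (sym_diff (f ` (A \<inter> U)) B) < ennreal (e/2)"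
    using e U by (intro ballI D(3) img) auto
  then obtain d where d: "\<And>A. A \<in> sets M \<Longrightarrow> d A \<in> D"
    "\<And>A. A \<in> sets M \<Longrightarrow> emeasure lebesgue (sym_diff (f ` (A \<inter> U)) (d A)) < ennreal (e/2)"
    by metis
  have "measure M (sym_diff A B) < e"
    if A: "A \<in> sets M" and B: "B \<in> sets M" and eq: "to_nat_on D (d A) = to_nat_on D (d B)" for A B
  proof -
    have dAB: "d A = d B" using eq D(1) d(1) A B by (simp add: to_nat_on_inj)
    have m: "f ` (A \<inter> U) \<in> sets lebesgue" "f ` (B \<inter> U) \<in> sets lebesgue"
      "d A \<in> sets lebesgue"
      using A B U D(2) d(1) by (auto intro!: img)
    \<comment> \<open>The isomorphism preserves the measure of the completion, and only for sets
      inside the conull set \<open>U\<close>; so the measure is moved to the completion and the set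
      is cut down to \<open>U\<close> before taking images.\<close>
    have "emeasure M (sym_diff A B) = emeasure (completion M) (sym_diff A B)"
      using A B by simp
    also have "\<dots> = emeasure (completion M) (sym_diff A B \<inter> U)"
    proof (rule emeasure_eq_AE)
      have "AE x in completion M. x \<in> U"
        using U by (intro AE_I'[OF U(2)]) auto
      then show "AE x in completion M. (x \<in> sym_diff A B) = (x \<in> sym_diff A B \<inter> U)"
        by eventually_elim auto
    qed (use A B U in \<open>auto intro!: sets.Un sets.Diff sets.Int\<close>)
    also have "\<dots> = emeasure lebesgue (f ` (sym_diff A B \<inter> U))"
      using A B U by (intro img(3)[symmetric]) (auto intro!: sets.Un sets.Diff sets.Int)
    also have "f ` (sym_diff A B \<inter> U) = sym_diff (f ` (A \<inter> U)) (f ` (B \<inter> U))"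
      using inj unfolding inj_on_def by blast
    also have "emeasure lebesgue \<dots> \<le>
        emeasure lebesgue (sym_diff (f ` (A \<inter> U)) (d A) \<union> sym_diff (f ` (B \<inter> U)) (d B))"
      using m dAB by (intro emeasure_mono sets.Un sets.Diff) auto
    also have "\<dots> \<le> emeasure lebesgue (sym_diff (f ` (A \<inter> U)) (d A)) + emeasure lebesgue (sym_diff (f ` (B \<inter> U)) (d B))"
      using m dAB by (intro emeasure_subadditive sets.Un sets.Diff) auto
    also have "\<dots> < ennreal (e/2) + ennreal (e/2)"
      using d A B by (intro add_strict_mono) auto
    also have "\<dots> = ennreal e"
      using e by (simp flip: ennreal_plus)
    finally show ?thesis using e by (simp add: emeasure_eq_measure ennreal_less_iff)
  qed
  then show ?thesis by (rule that[of "\<lambda>A. to_nat_on D (d A)"])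
qed

text \<open>Pull back an interval of length \<open>min 1 e\<close>. These sets become the bases
  \<open>F\<close> of the towers built below.\<close>

lemma nonatomic_lebesgue_space_small_set:
  assumes M: "nonatomic_lebesgue_space M" and e: "e > 0"
  obtains F where "F \<in> sets M" "0 < measure M F" "measure M F \<le> e"
proof -
  interpret prob_space M using M by (simp add: nonatomic_lebesgue_space_def)
  obtain f U V where 1: "iso_mod0_on (completion M) (lebesgue_on {0..1::real}) U V f"
    using M by (auto simp: nonatomic_lebesgue_space_def)
  have UV: "U \<in> sets (completion M)" "V \<in> sets (lebesgue_on {0..1})"
      "{0..1} - V \<in> null_sets (lebesgue_on {0..1})" "f ` U = V"
    and f: "f \<in> restrict_space (completion M) U \<rightarrow>\<^sub>M restrict_space (lebesgue_on {0..1}) V"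
    using 1 by (auto simp: iso_mod0_on_def bij_betw_def)
  define t where "t = min 1 e"
  have t: "0 < t" "t \<le> 1" "t \<le> e" using e by (auto simp: t_def)
  define G where "G = f -` ({0..t} \<inter> V) \<inter> U"
  have I: "{0..t} \<in> sets (lebesgue_on {0..1})"
    using t by (auto simp: sets_restrict_space_iff)
  have "{0..t} \<inter> V \<in> sets (restrict_space (lebesgue_on {0..1}) V)"
    using I UV by (subst sets_restrict_space_iff) auto
  then have "f -` ({0..t} \<inter> V) \<inter> space (restrict_space (completion M) U) \<in> sets (restrict_space (completion M) U)"
    by (rule measurable_sets[OF f])
  also have "f -` ({0..t} \<inter> V) \<inter> space (restrict_space (completion M) U) = G"
    using sets.sets_into_space[OF UV(1)] by (auto simp: space_restrict_space G_def)
  finally have G: "G \<in> sets (completion M)"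
    using UV(1) by (subst (asm) sets_restrict_space_iff) auto
  have fG: "f ` G = {0..t} \<inter> V" using UV(4) by (auto simp: G_def)
  \<comment> \<open>\<open>G\<close> is measurable only for the completion; its main part lies in
    \<open>sets M\<close> and has the same measure.\<close>
  have "emeasure M (main_part M G) = emeasure (completion M) G" using G by simp
  also have "\<dots> = emeasure (lebesgue_on {0..1}) (f ` G)"
    using 1 G by (auto simp: iso_mod0_on_def G_def)
  also have "\<dots> = emeasure (lebesgue_on {0..1}) {0..t}"
  proof (rule emeasure_eq_AE)
    have "AE x in lebesgue_on {0..1}. x \<in> V" by (intro AE_I'[OF UV(3)]) auto
    then show "AE x in lebesgue_on {0..1}. (x \<in> f ` G) = (x \<in> {0..t})"
      by eventually_elim (auto simp: fG)
  qed (use I UV fG in auto)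
  also have "\<dots> = ennreal t"
    using t by (subst emeasure_restrict_space) auto
  finally have "measure M (main_part M G) = t" using t by (simp add: measure_def)
  then show ?thesis using that[of "main_part M G"] G t by simp
qed

section \<open>Ergodic set maps\<close>

text \<open>The model is \<open>A\<close> mapped to \<open>T\<close> followed by intersection with a
  fixed conull set inside the image, so the set identities hold exactly and not just modulo null
  sets. Ergodicity takes the form for sets that are mapped into themselves, which are invariant
  modulo null sets because measure is preserved.\<close>

locale ergodic_set_map = prob_space M for M :: "'a measure" +
  fixes S :: "'a set \<Rightarrow> 'a set"
  assumes S_sets: "A \<in> sets M \<Longrightarrow> S A \<in> sets M"
    and S_prob: "A \<in> sets M \<Longrightarrow> prob (S A) = prob A"
    and S_Diff: "S (A - B) = S A - S B"
    and S_UN: "S (\<Union>i\<in>I. C i) = (\<Union>i\<in>(I :: nat set). S (C i))"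
    and S_ergodic: "A \<in> sets M \<Longrightarrow> S A \<subseteq> A \<Longrightarrow> 0 < prob A \<Longrightarrow> prob A = 1"
begin

lemma S_Un: "S (A \<union> B) = S A \<union> S B"
  using S_UN[of "\<lambda>i. if i = 0 then A else B" "{0, 1}"] by (simp add: Un_commute)

lemma S_sym_diff: "S (sym_diff A B) = sym_diff (S A) (S B)"
  by (simp add: S_Un S_Diff)

lemma
  shows funpow_S_sets: "A \<in> sets M \<Longrightarrow> (S ^^ n) A \<in> sets M"
    and funpow_S_prob: "A \<in> sets M \<Longrightarrow> prob ((S ^^ n) A) = prob A"
    and funpow_S_Diff: "(S ^^ n) (A - B) = (S ^^ n) A - (S ^^ n) B"
    and funpow_S_UN: "(S ^^ n) (\<Union>i\<in>I. C i) = (\<Union>i\<in>(I :: nat set). (S ^^ n) (C i))"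
    and funpow_S_sym_diff: "(S ^^ n) (sym_diff A B) = sym_diff ((S ^^ n) A) ((S ^^ n) B)"
proof -
  have sets: "(S ^^ n) A \<in> sets M" if "A \<in> sets M" for n
    using that by (induction n) (auto intro: S_sets)
  then show "A \<in> sets M \<Longrightarrow> (S ^^ n) A \<in> sets M" .
  show "prob ((S ^^ n) A) = prob A" if "A \<in> sets M"
    using that by (induction n) (auto simp: S_prob sets)
  show "(S ^^ n) (A - B) = (S ^^ n) A - (S ^^ n) B"
    by (induction n) (auto simp: S_Diff)
  show "(S ^^ n) (\<Union>i\<in>I. C i) = (\<Union>i\<in>I. (S ^^ n) (C i))"
    by (induction n) (simp_all add: S_UN)
  show "(S ^^ n) (sym_diff A B) = sym_diff ((S ^^ n) A) ((S ^^ n) B)"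
    by (induction n) (simp_all add: S_sym_diff)
qed

text \<open>Telescoping: each of the \<open>n\<close> steps contributes an image of
  \<open>sym_diff (S A) A\<close>, and all these images have the same measure.\<close>

lemma prob_sym_diff_funpow_le:
  assumes "A \<in> sets M"
  shows "prob (sym_diff ((S ^^ n) A) A) \<le> n * prob (sym_diff (S A) A)"
proof (induction n)
  case (Suc n)
  let ?D = "sym_diff (S A) A" and ?E = "sym_diff ((S ^^ n) A) A"
  have m: "?D \<in> sets M" "?E \<in> sets M"
    using assms by (auto intro!: sets_sym_diff S_sets funpow_S_sets)
  have "sym_diff ((S ^^ Suc n) A) A \<subseteq> (S ^^ n) ?D \<union> ?E"
    unfolding funpow_S_sym_diff funpow_Suc_right comp_def by auto
  then have "prob (sym_diff ((S ^^ Suc n) A) A) \<le> prob ((S ^^ n) ?D \<union> ?E)"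
    using sets.Un[OF funpow_S_sets[OF m(1)] m(2)] by (rule finite_measure_mono)
  also have "\<dots> \<le> prob ((S ^^ n) ?D) + prob ?E"
    using m by (intro measure_Un_le funpow_S_sets)
  finally show ?case
    using Suc m by (simp add: funpow_S_prob algebra_simps)
qed simp

text \<open>The levels \<open>L k\<close> record the time \<open>k\<close> since the last visit to \<open>F\<close>. The set \<open>B\<close> switches every \<open>N\<close>
  levels, so one step changes little and \<open>N\<close> steps complement it; the phase \<open>t\<close> is chosen so that
  the switching levels have small measure.\<close>
lemma slow_set_exists:
  assumes F: "F \<in> sets M" "0 < prob F" "N * prob F \<le> 1/2" and N: "N > 0"
  obtains B where "B \<in> sets M" "prob (sym_diff (S B) B) \<le> 2 / N"
    "1/2 \<le> prob (sym_diff ((S ^^ N) B) B)"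
proof -
  define A where "A k = (S ^^ k) F" for k
  define L where "L = disjointed A"
  define P where "P K = (\<Union>k\<in>K. L k)" for K
  have A: "A k \<in> sets M" "prob (A k) = prob F" for k
    using F by (simp_all add: A_def funpow_S_sets funpow_S_prob)
  have funpow_A: "(S ^^ n) (A k) = A (k + n)" for n k
    unfolding A_def by (subst add.commute) (simp add: funpow_add)
  have L: "L k \<in> sets M" for k
    unfolding L_def using A by (meson image_subset_iff rangeI sets.range_disjointed_sets subsetD)
  then have P: "P K \<in> sets M" for K
    unfolding P_def by auto
  have disj: "i = j" if "x \<in> L i" "x \<in> L j" for x i j
    using that disjoint_family_disjointed[of A] unfolding L_def disjoint_family_on_def by blast
  \<comment> \<open>\<open>(S ^^ n) (L k)\<close> is \<open>A (k + n)\<close> without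
    \<open>A n\<close>, ..., \<open>A (k + n - 1)\<close>, whereas \<open>L (k + n)\<close> also
    omits the first \<open>n\<close> images of \<open>F\<close>. Off those images the two
    agree.\<close>
  have shift: "x \<in> (S ^^ n) (L k) \<longleftrightarrow> x \<in> L (k + n)" if x: "x \<notin> (\<Union>i<n. A i)" for x n k
  proof -
    have "(S ^^ n) (L k) = A (k + n) - (\<Union>i\<in>{0..<k}. A (i + n))"
      unfolding L_def disjointed_def by (simp add: funpow_S_Diff funpow_S_UN funpow_A)
    moreover have "(\<Union>i\<in>{0..<k+n}. A i) = (\<Union>i<n. A i) \<union> (\<Union>i\<in>{0..<k}. A (i + n))"
    proof -
      have "{0..<k+n} = {..<n} \<union> (\<lambda>i. i + n) ` {0..<k}"
        by (auto simp: image_iff)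
      then show ?thesis by (simp only: UN_Un image_image)
    qed
    ultimately show ?thesis using x unfolding L_def disjointed_def by auto
  qed
  have shift_P: "x \<in> (S ^^ n) (P K) \<longleftrightarrow> (\<exists>k\<in>K. x \<in> L (k + n))" if x: "x \<notin> (\<Union>i<n. A i)" for x n K
    unfolding P_def funpow_S_UN using shift[OF x] by auto
  have L0: "L 0 = F" by (simp add: L_def disjointed_def A_def)

  \<comment> \<open>Averaging: the \<open>N\<close> residue classes of levels are disjoint, so their
    measures sum to at most 1.\<close>
  have "\<exists>t<N. prob (P {k. k mod N = t}) \<le> 1 / N"
  proof (rule ccontr)
    assume "\<not> ?thesis"
    then have "(\<Sum>t<N. 1 / real N) < (\<Sum>t<N. prob (P {k. k mod N = t}))"
      using N by (intro sum_strict_mono) (auto simp: not_le)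
    also have "\<dots> = prob (\<Union>t<N. P {k. k mod N = t})"
    proof (intro finite_measure_finite_Union[symmetric])
      show "disjoint_family_on (\<lambda>t. P {k. k mod N = t}) {..<N}"
        unfolding disjoint_family_on_def
      proof safe
        fix i j x assume "i \<noteq> j" "x \<in> P {k. k mod N = i}" "x \<in> P {k. k mod N = j}"
        then show "x \<in> {}" using disj by (auto simp: P_def)
      qed
      show "finite {..<N}" by simp
      show "(\<lambda>t. P {k. k mod N = t}) ` {..<N} \<subseteq> sets M" using P by blast
    qed
    also have "\<dots> \<le> 1" by simp
    finally show False using N by simp
  qed
  then obtain t where t: "t < N" "prob (P {k. k mod N = t}) \<le> 1 / N" by blast

  \<comment> \<open>Blocks of \<open>N\<close> consecutive levels are alternately in and out. Adding
    \<open>N - t\<close> instead of subtracting \<open>t\<close> stays within the naturals and puts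
    the block boundaries at the levels congruent to \<open>t\<close>.\<close>
  define K where "K = {k. even ((k + (N - t)) div N)}"
  have K_N: "k + N \<in> K \<longleftrightarrow> k \<notin> K" for k
  proof -
    have "k + N + (N - t) = (k + (N - t)) + N" by simp
    then have "(k + N + (N - t)) div N = Suc ((k + (N - t)) div N)"
      using N by (metis One_nat_def add.commute div_add_self2 not_less_zero plus_1_eq_Suc)
    then show ?thesis by (simp add: K_def)
  qed
  have K_Suc: "Suc k mod N = t" if "(Suc k \<in> K) \<noteq> (k \<in> K)" for k
  proof -
    have "Suc (k + (N - t)) mod N = 0"
      using that by (auto simp: K_def div_Suc split: if_splits)
    then have "(Suc k + (N - t) + t) mod N = t mod N"
      by (metis add_0 add_Suc mod_add_left_eq)
    moreover have "Suc k + (N - t) + t = Suc k + N" using t by simp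
    ultimately have "(Suc k + N) mod N = t mod N" by (simp only:)
    then show ?thesis using t(1) by (simp only: mod_add_self2 mod_less)
  qed

  \<comment> \<open>Off \<open>F\<close>, the map \<open>S\<close> raises levels by one, so
    membership changes only at a level \<open>Suc k\<close> where \<open>K\<close> switches. Level
    0, which has no predecessor, is \<open>F\<close> itself.\<close>
  have "sym_diff (S (P K)) (P K) \<subseteq> F \<union> P {k. k mod N = t}"
  proof
    fix x assume x: "x \<in> sym_diff (S (P K)) (P K)"
    show "x \<in> F \<union> P {k. k mod N = t}"
    proof (cases "x \<in> F")
      case False
      then have sh: "x \<in> S (P K) \<longleftrightarrow> (\<exists>k\<in>K. x \<in> L (Suc k))"
        using shift_P[of x 1 K] by (simp add: A_def)
      have Piff: "x \<in> P K \<longleftrightarrow> (\<exists>k\<in>K. x \<in> L k)" by (simp add: P_def)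
      consider k where "k \<in> K" "x \<in> L (Suc k)" "x \<notin> P K"
        | k where "k \<in> K" "x \<in> L k" "x \<notin> S (P K)"
        using x sh Piff by blast
      then obtain k where k: "x \<in> L (Suc k)" "(Suc k \<in> K) \<noteq> (k \<in> K)"
      proof cases
        case (1 k)
        then show ?thesis using that[of k] by (auto simp: P_def)
      next
        case (2 k)
        then show ?thesis using that[of "k - 1"] False L0 sh by (cases k) auto
      qed
      then show ?thesis using K_Suc[of k] by (auto simp: P_def)
    qed simp
  qed
  then have "prob (sym_diff (S (P K)) (P K)) \<le> prob (F \<union> P {k. k mod N = t})"
    using F P by (intro finite_measure_mono) auto
  also have "\<dots> \<le> prob F + prob (P {k. k mod N = t})"
    using F P by (intro measure_Un_le) auto
  also have "\<dots> \<le> 1 / N + 1 / N"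
    using t(2) F(3) N by (intro add_mono) (auto simp: field_simps)
  finally have step: "prob (sym_diff (S (P K)) (P K)) \<le> 2 / N" by simp

  \<comment> \<open>By ergodicity the forward orbit of \<open>F\<close> has full measure. Its first
    \<open>N\<close> images cover at most half of the space, so at least half lies at levels
    \<open>N\<close> and above.\<close>
  define W where "W = (\<Union>k. A k)"
  have W: "W \<in> sets M" using A unfolding W_def by auto
  have "S W \<subseteq> W"
    using funpow_A[of 1] unfolding W_def S_UN by auto
  moreover have "prob (A 0) \<le> prob W"
    using W by (intro finite_measure_mono) (auto simp: W_def)
  ultimately have "prob W = 1"
    using F W A by (intro S_ergodic) auto
  have "prob (\<Union>i<N. A i) \<le> (\<Sum>i<N. prob (A i))"
    using A by (intro finite_measure_subadditive_finite) auto
  also have "\<dots> \<le> 1/2" using A F by simp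
  finally have "1/2 \<le> prob W - prob (\<Union>i<N. A i)" using \<open>prob W = 1\<close> by simp
  also have "\<dots> = prob (W - (\<Union>i<N. A i))"
    using A W by (intro finite_measure_Diff[symmetric]) (auto simp: W_def)
  also have "\<dots> \<le> prob (sym_diff ((S ^^ N) (P K)) (P K))"
  proof (rule finite_measure_mono)
    \<comment> \<open>Such a point has a level \<open>j + N\<close>. It lies in \<open>P K\<close>
      iff \<open>j + N\<close> is in \<open>K\<close>, and in \<open>(S ^^ N) (P K)\<close> iff
      \<open>j\<close> is; by \<open>K_N\<close> exactly one of these holds.\<close>
    show "W - (\<Union>i<N. A i) \<subseteq> sym_diff ((S ^^ N) (P K)) (P K)"
    proof
      fix x assume x: "x \<in> W - (\<Union>i<N. A i)"
      then obtain k where k: "x \<in> L k"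
        using UN_disjointed_eq[of A] unfolding W_def L_def by blast
      then have "x \<in> A k" using disjointed_subset[of A k] by (auto simp: L_def)
      then have "N \<le> k" using x by (auto simp: not_less[symmetric])
      then obtain j where j: "k = j + N" by (metis add.commute le_Suc_ex)
      have "x \<in> P K \<longleftrightarrow> j + N \<in> K"
        using k disj unfolding P_def j by blast
      moreover have "x \<in> (S ^^ N) (P K) \<longleftrightarrow> j \<in> K"
        using shift_P[of x N K] x k disj unfolding j by (metis DiffD2 add_right_cancel)
      ultimately show "x \<in> sym_diff ((S ^^ N) (P K)) (P K)" using K_N[of j] by auto
    qed
    show "sym_diff ((S ^^ N) (P K)) (P K) \<in> sets M"
      using P by (intro sets_sym_diff funpow_S_sets)
  qed
  finally show ?thesis using that[OF P step] by blast
qed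

text \<open>Two of these cocycles, with first difference of the indices at \<open>s\<close>, differ by the coboundary of
  \<open>B s\<close> up to a set much smaller than \<open>1 / 16 ^ s\<close>. If they differ by the coboundary of \<open>b\<close>, then
  \<open>b + B s\<close> is still almost invariant under \<open>S ^^ 16 ^ s\<close>, while \<open>B s\<close> is far from being so.\<close>
lemma separated_cocycles:
  assumes small: "\<And>e. e > 0 \<Longrightarrow> \<exists>F\<in>sets M. 0 < prob F \<and> prob F \<le> e"
  obtains f :: "nat set \<Rightarrow> 'a set" where "\<And>\<omega>. f \<omega> \<in> sets M"
    "\<And>\<omega> \<omega>' b. \<omega> \<noteq> \<omega>' \<Longrightarrow> b \<in> sets M \<Longrightarrow>
       sym_diff (sym_diff (f \<omega>) (f \<omega>')) (sym_diff (S b) b) \<in> null_sets M \<Longrightarrow> 1/8 \<le> prob b"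
proof -
  have "\<exists>B. B \<in> sets M \<and> prob (sym_diff (S B) B) \<le> 2 / 16 ^ n \<and>
      1/2 \<le> prob (sym_diff ((S ^^ (16 ^ n)) B) B)" for n :: nat
  proof -
    obtain F where F: "F \<in> sets M" "0 < prob F" "prob F \<le> 1 / (2 * 16 ^ n)"
      using small[of "1 / (2 * 16 ^ n)"] by auto
    have "real (16 ^ n) * prob F \<le> 1/2" using F(3) by (simp add: field_simps)
    then show ?thesis using slow_set_exists[OF F(1,2), of "16 ^ n"] by fastforce
  qed
  then obtain B where B: "\<And>n. B n \<in> sets M" "\<And>n. prob (sym_diff (S (B n)) (B n)) \<le> 2 / 16 ^ n"
      "\<And>n. 1/2 \<le> prob (sym_diff ((S ^^ (16 ^ n)) (B n)) (B n))"
    by metis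
  define E where "E n = sym_diff (S (B n)) (B n)" for n
  have E[measurable]: "E n \<in> sets M" for n
    unfolding E_def using B by (intro sets_sym_diff S_sets)
  \<comment> \<open>The infinite sum of the \<open>E n\<close> is taken as a parity. Points lying in
    infinitely many of the selected \<open>E n\<close> are left out, since \<open>card\<close> is 0
    there; parities are compared only off the tail \<open>R\<close>, where the index sets are
    finite.\<close>
  define f where "f \<omega> = {x \<in> space M. odd (card {n. n \<in> \<omega> \<and> x \<in> E n})}" for \<omega>
  have f: "f \<omega> \<in> sets M" for \<omega> unfolding f_def by measurable
  have main: "1/8 \<le> prob b"
    if s: "s \<in> \<omega>" "s \<notin> \<omega>'" and below: "\<And>n. n < s \<Longrightarrow> n \<in> \<omega> \<longleftrightarrow> n \<in> \<omega>'" and b: "b \<in> sets M"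
      and null: "sym_diff (sym_diff (f \<omega>) (f \<omega>')) (sym_diff (S b) b) \<in> null_sets M" for \<omega> \<omega>' b s
  proof -
    \<comment> \<open>The tail beyond \<open>s\<close> has measure at most
      \<open>2 / 15 / 16 ^ s\<close> by the geometric series. The base 16 keeps this small even
      after multiplication by the \<open>16 ^ s\<close> steps that move \<open>B s\<close> by at
      least \<open>1/2\<close>.\<close>
    define R where "R = (\<Union>k. E (k + Suc s))"
    have R: "R \<in> sets M" unfolding R_def by measurable
    have sums: "(\<lambda>k. 2 / 16 ^ (k + Suc s)) sums (2 / 15 / 16 ^ s :: real)"
      using sums_mult[OF geometric_sums[of "1/16::real"], of "2 / 16 ^ Suc s"]
      by (simp add: power_add field_simps)
    have Ele: "prob (E k) \<le> 2 / 16 ^ k" for k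
      using B(2) by (simp add: E_def)
    have summ: "summable (\<lambda>k. prob (E (k + Suc s)))"
      by (rule summable_comparison_test'[OF sums_summable[OF sums], of 0]) (use Ele[of "_ + Suc s"] in simp)
    have "prob R \<le> (\<Sum>k. prob (E (k + Suc s)))"
      unfolding R_def using summ by (intro finite_measure_subadditive_countably) auto
    also have "\<dots> \<le> (\<Sum>k. 2 / 16 ^ (k + Suc s))"
      by (rule suminf_le[OF Ele summ sums_summable[OF sums]])
    also have "\<dots> = 2 / 15 / 16 ^ s" using sums by (rule sums_unique[symmetric])
    finally have probR: "prob R \<le> 2 / 15 / 16 ^ s" .

    \<comment> \<open>Off \<open>R\<close> only indices up to \<open>s\<close> count. Those below
      \<open>s\<close> contribute equally to both parities, and \<open>s\<close> itself contributes
      only to that of \<open>\<omega>\<close>.\<close>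
    have parity: "x \<in> sym_diff (f \<omega>) (f \<omega>') \<longleftrightarrow> x \<in> E s" if x: "x \<in> space M" "x \<notin> R" for x
    proof -
      have le: "n \<le> s" if "x \<in> E n" for n
      proof (rule ccontr)
        assume "\<not> n \<le> s"
        then have "n = (n - Suc s) + Suc s" by simp
        then show False using that x(2) unfolding R_def by (metis UNIV_I UN_I)
      qed
      define C where "C = {n. n \<in> \<omega>' \<and> x \<in> E n}"
      have C: "finite C" "s \<notin> C"
        using le s by (auto simp: C_def intro: finite_subset[of _ "{..s}"])
      have "{n. n \<in> \<omega> \<and> x \<in> E n} = (if x \<in> E s then insert s C else C)"
        using le s below by (auto simp: C_def) (metis le_neq_implies_less)+
      then show ?thesis
        using x(1) C by (auto simp: f_def C_def[symmetric])
    qed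
    define g where "g = sym_diff b (B s)"
    have g: "g \<in> sets M" unfolding g_def using b B by auto
    let ?Z = "sym_diff (sym_diff (f \<omega>) (f \<omega>')) (sym_diff (S b) b)"
    \<comment> \<open>Off \<open>R\<close> and the null set, the coboundaries of \<open>b\<close>
      and \<open>B s\<close> coincide, so they cancel in the coboundary of \<open>g\<close>.\<close>
    have "sym_diff (S g) g \<subseteq> R \<union> ?Z"
    proof
      fix x assume x: "x \<in> sym_diff (S g) g"
      then have "x \<in> space M" using g S_sets[OF g] sets.sets_into_space by blast
      moreover have "x \<in> sym_diff (S b) b \<longleftrightarrow> x \<notin> E s"
        using x unfolding g_def S_sym_diff E_def by blast
      ultimately show "x \<in> R \<union> ?Z" using parity[of x] by blast
    qed
    then have "prob (sym_diff (S g) g) \<le> prob (R \<union> ?Z)"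
      using sets.Un[OF R null_setsD2[OF null]] by (rule finite_measure_mono)
    also have "\<dots> = prob R" using R null by (intro measure_Un_null_set)
    finally have "prob (sym_diff (S g) g) \<le> 2 / 15 / 16 ^ s" using probR by simp
    then have g_inv: "prob (sym_diff ((S ^^ (16 ^ s)) g) g) \<le> 2 / 15"
      using prob_sym_diff_funpow_le[OF g, of "16 ^ s"] by (simp add: field_simps)

    \<comment> \<open>Since \<open>B s\<close> is the sum of \<open>g\<close> and \<open>b\<close>,
      its displacement is at most that of \<open>g\<close> plus \<open>2 * prob b\<close>. Hence
      \<open>1/2 \<le> 2/15 + 2 * prob b\<close>, which gives \<open>11/60\<close>, more than the
      claimed \<open>1/8\<close>.\<close>
    have sub: "sym_diff ((S ^^ (16 ^ s)) (B s)) (B s) \<subseteq>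
        sym_diff ((S ^^ (16 ^ s)) g) g \<union> ((S ^^ (16 ^ s)) b \<union> b)"
      unfolding g_def funpow_S_sym_diff by auto
    have m: "sym_diff ((S ^^ (16 ^ s)) g) g \<in> sets M" "(S ^^ (16 ^ s)) b \<in> sets M"
      using g b by (auto intro!: sets_sym_diff funpow_S_sets)
    have "1/2 \<le> prob (sym_diff ((S ^^ (16 ^ s)) (B s)) (B s))" by (rule B(3))
    also have "\<dots> \<le> prob (sym_diff ((S ^^ (16 ^ s)) g) g \<union> ((S ^^ (16 ^ s)) b \<union> b))"
      using m b by (intro finite_measure_mono[OF sub] sets.Un[OF m(1)] sets.Un)
    also have "\<dots> \<le> prob (sym_diff ((S ^^ (16 ^ s)) g) g) + prob ((S ^^ (16 ^ s)) b \<union> b)"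
      using m b by (intro measure_Un_le[OF m(1)] sets.Un)
    also have "\<dots> \<le> 2/15 + (prob b + prob b)"
      using g_inv measure_Un_le[OF m(2) b] funpow_S_prob[OF b] by (intro add_mono) auto
    finally show ?thesis by simp
  qed
  show ?thesis
  proof (rule that[of f])
    fix \<omega> \<omega>' :: "nat set" and b
    assume ne: "\<omega> \<noteq> \<omega>'" and b: "b \<in> sets M"
      and null: "sym_diff (sym_diff (f \<omega>) (f \<omega>')) (sym_diff (S b) b) \<in> null_sets M"
    define s where "s = (LEAST n. (n \<in> \<omega>) \<noteq> (n \<in> \<omega>'))"
    have s: "(s \<in> \<omega>) \<noteq> (s \<in> \<omega>')"
      using LeastI_ex[of "\<lambda>n. (n \<in> \<omega>) \<noteq> (n \<in> \<omega>')"] ne unfolding s_def by blast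
    have below: "n \<in> \<omega> \<longleftrightarrow> n \<in> \<omega>'" if "n < s" for n
      using not_less_Least[OF that[unfolded s_def]] by blast
    show "1/8 \<le> prob b"
    proof (cases "s \<in> \<omega>")
      case True
      then show ?thesis
        using s below by (intro main[OF _ _ _ b null]) auto
    next
      case False
      \<comment> \<open>The sum is symmetric, so the roles of the two index sets can be exchanged to
        have \<open>s\<close> in the first.\<close>
      have eq: "sym_diff (f \<omega>) (f \<omega>') = sym_diff (f \<omega>') (f \<omega>)" by blast
      show ?thesis
        using False s below by (intro main[OF _ _ _ b null[unfolded eq]]) auto
    qed
  qed (rule f)
qed

end

section \<open>The cohomology group\<close>

text \<open>Injectivity of \<open>T\<close> on \<open>U\<close> makes images commute with
  differences. If the image of \<open>A\<close> lies in \<open>A\<close>, equality of measures makes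
  the class of \<open>A\<close> invariant, and ergodicity applies to that class.\<close>

lemma ergodic_set_map_image:
  assumes M: "prob_space M" and iso: "iso_mod0_on M M U V T" and erg: "ergodic_mod0 M T"
  shows "ergodic_set_map M (\<lambda>A. T ` (A \<inter> U))"
proof -
  interpret prob_space M by fact
  have U: "U \<in> sets M" "space M - U \<in> null_sets M" and inj: "inj_on T U"
    and T: "\<And>A. A \<in> sets M \<Longrightarrow> A \<subseteq> U \<Longrightarrow> T ` A \<in> sets M \<and> emeasure M (T ` A) = emeasure M A"
    using iso by (auto simp: iso_mod0_on_def bij_betw_def)
  have T_prob: "prob (T ` (A \<inter> U)) = prob A" if A: "A \<in> sets M" for A
  proof -
    have "prob (T ` (A \<inter> U)) = prob (A \<inter> U)"
      using T[of "A \<inter> U"] A U by (simp add: measure_def)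
    also have "\<dots> = prob A"
    proof (rule measure_eq_AE)
      have "AE x in M. x \<in> U" using U by (intro AE_I'[OF U(2)]) auto
      then show "AE x in M. (x \<in> A \<inter> U) = (x \<in> A)" by eventually_elim auto
    qed (use A U in auto)
    finally show ?thesis .
  qed
  show ?thesis
  proof
    fix A assume A: "A \<in> sets M"
    show TA: "T ` (A \<inter> U) \<in> sets M" using T[of "A \<inter> U"] A U by simp
    show "prob (T ` (A \<inter> U)) = prob A" using A by (rule T_prob)
    assume sub: "T ` (A \<inter> U) \<subseteq> A" and pos: "0 < prob A"
    have "prob (A - T ` (A \<inter> U)) = 0"
      using finite_measure_Diff[OF A TA sub] T_prob[OF A] by simp
    then have null: "sym_diff (T ` (A \<inter> U)) A \<in> null_sets M"
      using A TA sub by (simp add: null_sets_def emeasure_eq_measure Diff_eq_empty_iff[THEN iffD2])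
    have "induced_map M T (ae_class M A) = ae_class M A"
      unfolding induced_map_ae_class[OF iso A] by (rule ae_class_cong[OF TA A null])
    then have "ae_class M A = ae_class M {} \<or> ae_class M A = ae_class M (space M)"
      using erg A unfolding ergodic_mod0_def carrier_measure_algebra by blast
    moreover have "A \<in> ae_class M A" using A by (simp add: ae_class_eq)
    ultimately have "A \<in> null_sets M \<or> space M - A \<in> null_sets M"
      using sets.sets_into_space[OF A]
      by (auto simp: ae_class_eq Diff_eq_empty_iff[THEN iffD2])
    then show "prob A = 1"
      using pos prob_compl[OF A] by (auto simp: null_sets_def measure_def)
  qed (use inj in \<open>auto simp: inj_on_def\<close>)
qed

lemma ae_class_eqD:
  assumes "B \<in> sets M" "ae_class M A = ae_class M B" "A \<in> sets M"
  shows "sym_diff A B \<in> null_sets M"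
proof -
  have "B \<in> ae_class M B" using assms(1) by (simp add: ae_class_eq)
  then show ?thesis unfolding assms(2)[symmetric] ae_class_eq[OF assms(3)] by blast
qed

theorem theorem1:
  fixes M :: "'a measure" and T :: "'a \<Rightarrow> 'a"
  assumes "nonatomic_lebesgue_space M"
    and "automorphism_mod0 M T"
    and "ergodic_mod0 M T"
  shows "uncountable (carrier (cohomology_group M T))"
proof
  assume count: "countable (carrier (cohomology_group M T))"
  interpret prob_space M using assms(1) by (simp add: nonatomic_lebesgue_space_def)
  obtain U V where iso: "iso_mod0_on M M U V T"
    using assms(2) by (auto simp: automorphism_mod0_def)
  define S where "S A = T ` (A \<inter> U)" for A
  interpret ergodic_set_map M S
    unfolding S_def using prob_space_axioms iso assms(3) by (rule ergodic_set_map_image)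
  interpret MA: comm_group "measure_algebra M" by (rule comm_group_measure_algebra)
  note coset_defs = cohomology_group_def FactGroup_def RCOSETS_def carrier_measure_algebra

  obtain f :: "nat set \<Rightarrow> 'a set" where f: "\<And>\<omega>. f \<omega> \<in> sets M"
    and sep: "\<And>\<omega> \<omega>' b. \<omega> \<noteq> \<omega>' \<Longrightarrow> b \<in> sets M \<Longrightarrow>
       sym_diff (sym_diff (f \<omega>) (f \<omega>')) (sym_diff (S b) b) \<in> null_sets M \<Longrightarrow> 1/8 \<le> prob b"
    using separated_cocycles nonatomic_lebesgue_space_small_set[OF assms(1)] by metis
  obtain c :: "'a set \<Rightarrow> nat" where
    c: "\<And>A B. A \<in> sets M \<Longrightarrow> B \<in> sets M \<Longrightarrow> c A = c B \<Longrightarrow> prob (sym_diff A B) < 1/8"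
    using nonatomic_lebesgue_space_colouring[OF assms(1), of "1/8"] by auto

  define q where "q \<omega> = coboundaries M T #>\<^bsub>measure_algebra M\<^esub> ae_class M (f \<omega>)" for \<omega>
  have q: "q \<omega> \<in> carrier (cohomology_group M T)" for \<omega>
    using f unfolding q_def coset_defs by auto
  have "\<forall>h\<in>carrier (cohomology_group M T). \<exists>A\<in>sets M. h = coboundaries M T #>\<^bsub>measure_algebra M\<^esub> ae_class M A"
    unfolding coset_defs by auto
  then obtain C where C: "\<And>h. h \<in> carrier (cohomology_group M T) \<Longrightarrow> C h \<in> sets M"
    "\<And>h. h \<in> carrier (cohomology_group M T) \<Longrightarrow> h = coboundaries M T #>\<^bsub>measure_algebra M\<^esub> ae_class M (C h)"
    by metis
  \<comment> \<open>Each \<open>f \<omega>\<close> is, modulo null sets, the chosen representative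
    of its cohomology class plus the coboundary of some \<open>b\<close>.\<close>
  have "\<exists>b\<in>sets M. sym_diff (f \<omega>) (sym_diff (sym_diff (S b) b) (C (q \<omega>))) \<in> null_sets M" for \<omega>
  proof -
    have "ae_class M (f \<omega>) \<in> q \<omega>"
      unfolding q_def using f by (intro MA.rcos_self subgroup_coboundaries assms) (simp add: carrier_measure_algebra)
    then have "ae_class M (f \<omega>) \<in> coboundaries M T #>\<^bsub>measure_algebra M\<^esub> ae_class M (C (q \<omega>))"
      using C(2)[OF q] by simp
    then obtain b where b: "b \<in> sets M" and eq: "ae_class M (f \<omega>) =
        induced_map M T (ae_class M b) \<otimes>\<^bsub>measure_algebra M\<^esub> ae_class M b \<otimes>\<^bsub>measure_algebra M\<^esub> ae_class M (C (q \<omega>))"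
      unfolding r_coset_def coboundaries_def carrier_measure_algebra by auto
    have m1: "sym_diff (S b) b \<in> sets M"
      using S_sets[OF b] b by (rule sets_sym_diff)
    then have m2: "sym_diff (sym_diff (S b) b) (C (q \<omega>)) \<in> sets M"
      using C(1)[OF q] by (rule sets_sym_diff)
    have "ae_class M (f \<omega>) = ae_class M (sym_diff (sym_diff (S b) b) (C (q \<omega>)))"
      using eq b S_sets[OF b] C(1)[OF q] m1
      unfolding induced_map_ae_class[OF iso b] S_def[symmetric] by (simp only: mult_ae_class)
    then show ?thesis using ae_class_eqD[OF m2 _ f] b by blast
  qed
  then obtain b where b: "\<And>\<omega>. b \<omega> \<in> sets M"
    "\<And>\<omega>. sym_diff (f \<omega>) (sym_diff (sym_diff (S (b \<omega>)) (b \<omega>)) (C (q \<omega>))) \<in> null_sets M"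
    by metis

  \<comment> \<open>If the classes were countable, the class of \<open>f \<omega>\<close> and the
    colour of \<open>b \<omega>\<close> could be coded together by one natural number.\<close>
  define h where "h \<omega> = prod_encode (to_nat_on (carrier (cohomology_group M T)) (q \<omega>), c (b \<omega>))" for \<omega>
  have "inj h"
  proof (rule injI, rule ccontr)
    fix \<omega> \<omega>' assume "h \<omega> = h \<omega>'" and ne: "\<omega> \<noteq> \<omega>'"
    then have qq: "q \<omega> = q \<omega>'" and cc: "c (b \<omega>) = c (b \<omega>')"
      using count q by (auto simp: h_def to_nat_on_inj)
    let ?b = "sym_diff (b \<omega>) (b \<omega>')"
    let ?Z = "\<lambda>\<omega>. sym_diff (f \<omega>) (sym_diff (sym_diff (S (b \<omega>)) (b \<omega>)) (C (q \<omega>)))"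
    \<comment> \<open>The common representative cancels, so the two cocycles differ by the
      coboundary of \<open>?b\<close>. Separation then forces measure at least \<open>1/8\<close>,
      while equal colours give less.\<close>
    have "sym_diff (sym_diff (f \<omega>) (f \<omega>')) (sym_diff (S ?b) ?b) = sym_diff (?Z \<omega>) (?Z \<omega>')"
      unfolding S_sym_diff qq by blast
    also have "\<dots> \<in> null_sets M"
      by (intro null_sets.Un[OF null_sets.Diff null_sets.Diff] b(2))
    finally have "1/8 \<le> prob ?b"
      using b(1) by (intro sep[OF ne]) auto
    with c[OF b(1) b(1) cc] show False by simp
  qed
  \<comment> \<open>An injection of the sets of naturals into the naturals yields a surjection the
    other way, against Cantor.\<close>
  then have "range (inv_into UNIV h) = Pow UNIV" by (simp add: inj_imp_surj_inv)
  then show False using Cantors_theorem by blast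
qed

end
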